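(* For each choice of sign $\varepsilon\in\{1,-1\}$ and all non-negative integers $\alpha,\beta\le 15$, define the coefficients $a(n)$, $b_\alpha(n)$, $c_\beta(n)$ (depending on $\varepsilon$) by the power series expansions $$\sum_{n=0}^{\infty}a(n)q^n=\left(q,q^4;q^5\right)_\infty\left(\varepsilon q^6,\varepsilon q^9;q^{15}\right)_\infty^2,$$ $$\sum_{n=0}^{\infty}b_\alpha(n)q^n=\left(\varepsilon q,\varepsilon q^4;q^5\right)_\infty^2\left(q^\alpha,q^{15-\alpha};q^{15}\right)_\infty,$$ $$\sum_{n=0}^{\infty}c_\beta(n)q^n=\left(\varepsilon q^2,\varepsilon q^3;q^5\right)_\infty^2\left(q^\beta,q^{15-\beta};q^{15}\right)_\infty.$$ Then, for each choice of $\varepsilon\in\{1,-1\}$ and all integers $n\ge 0$, $$a(5n+3)=0,$$ $$b_2(5n+2)=b_3(5n+4)=b_7(5n+3)=0,$$ $$c_1(5n+3)=c_4(5n+4)=c_6(5n+1)=0.$$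
   Context: For complex numbers $a,q$ with $|q|<1$, $(a;q)_\infty:=\prod_{k=0}^{\infty}(1-aq^k)$ and $(a_1,a_2,\dots,a_m;q)_\infty:=(a_1;q)_\infty(a_2;q)_\infty\cdots(a_m;q)_\infty$. The exponent $2$ on a product $(a_1,a_2;q)_\infty^2$ means the square of the whole product $(a_1,a_2;q)_\infty$. The infinite products are expanded as power series in $q$. *)

theory Defs
  imports "HOL-Complex_Analysis.Complex_Analysis"
begin

definition qpoch_inf :: "complex \<Rightarrow> complex \<Rightarrow> complex" where
  "qpoch_inf a q = (\<Prod>k. 1 - a * q ^ k)"

definition qpoch_inf_list :: "complex list \<Rightarrow> complex \<Rightarrow> complex" where
  "qpoch_inf_list as q = (\<Prod>a\<leftarrow>as. qpoch_inf a q)"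

text \<open>
  The infinite product is only meaningful for \<open>norm q < 1\<close>, where it converges. The products
  studied here are holomorphic in the unit disc, hence have a power series expansion at the
  origin (\<open>qproduct_has_fps_expansion\<close>), unique by \<open>fps_expansion_unique_complex\<close>.
\<close>

lemma convergent_prod_qpoch_inf:
  assumes "norm (q :: complex) < 1"
  shows "convergent_prod (\<lambda>k. 1 - a * q ^ k)"
proof -
  have "summable (\<lambda>k. norm a * norm q ^ k)"
    using assms by (intro summable_mult summable_geometric) auto
  hence "summable (\<lambda>k. norm (1 - a * q ^ k - 1))"
    by (simp add: norm_mult norm_power)
  thus ?thesis
    by (intro abs_convergent_prod_imp_convergent_prod)
       (simp add: abs_convergent_prod_conv_summable)
qed

lemma qpoch_inf_holomorphic:
  fixes g :: "complex \<Rightarrow> complex"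
  assumes g: "g holomorphic_on ball 0 1" and m: "m > 0"
  shows "(\<lambda>q. qpoch_inf (g q) (q ^ m)) holomorphic_on ball 0 1"
proof (rule holomorphic_uniform_sequence)
  show "open (ball 0 1 :: complex set)" by simp
  show "(\<lambda>q. \<Prod>k<n. 1 - g q * (q ^ m) ^ k) holomorphic_on ball 0 1" for n
    by (intro holomorphic_intros g)
  fix x :: complex assume x: "x \<in> ball 0 1"
  obtain d where d: "d > 0" "cball x d \<subseteq> ball 0 1"
    using open_contains_cball[of "ball (0::complex) 1"] x by (metis open_ball)
  define A where "A = cball x d"
  have A: "compact A" "A \<subseteq> ball 0 1" using d by (auto simp: A_def)
  have contg: "continuous_on A g"
    using holomorphic_on_imp_continuous_on[OF g] A(2) continuous_on_subset by blast
  have "bounded (g ` A)"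
    using A(1) contg compact_continuous_image compact_imp_bounded by blast
  then obtain C where C: "\<And>q. q \<in> A \<Longrightarrow> norm (g q) \<le> C"
    unfolding bounded_iff by auto
  have "compact ((\<lambda>q. norm (q ^ m)) ` A)"
    by (intro compact_continuous_image continuous_intros A)
  moreover have "(\<lambda>q. norm (q ^ m)) ` A \<noteq> {}" using d by (auto simp: A_def)
  ultimately obtain q0 where q0: "q0 \<in> A" "\<And>q. q \<in> A \<Longrightarrow> norm (q ^ m) \<le> norm (q0 ^ m)"
    using compact_attains_sup[of "(\<lambda>q. norm (q ^ m)) ` A"] by auto
  define r where "r = norm (q0 ^ m)"
  have r: "r \<ge> 0" "r < 1"
    using q0(1) A(2) m by (auto simp: r_def norm_power power_less_one_iff)
  have "uniformly_convergent_on A (\<lambda>N q. \<Prod>k<N. 1 - g q * (q ^ m) ^ k)"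
  proof (rule uniformly_convergent_on_prod')
    show "continuous_on A (\<lambda>q. 1 - g q * (q ^ m) ^ n)" for n
      by (intro continuous_intros contg)
    show "compact A" by fact
    show "uniformly_convergent_on A (\<lambda>N q. \<Sum>n<N. norm (1 - g q * (q ^ m) ^ n - 1))"
    proof (rule Weierstrass_m_test')
      show "norm (norm (1 - g q * (q ^ m) ^ n - 1)) \<le> C * r ^ n" if "q \<in> A" for n q
        using C[OF that] q0(2)[OF that] order_trans[OF norm_ge_zero C[OF that]]
        by (auto simp: norm_mult norm_power[of _ n] r_def intro!: mult_mono power_mono)
      show "summable (\<lambda>n. C * r ^ n)"
        using r by (intro summable_mult summable_geometric) auto
    qed
  qed
  then obtain l where l: "uniform_limit A (\<lambda>N q. \<Prod>k<N. 1 - g q * (q ^ m) ^ k) l sequentially"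
    unfolding uniformly_convergent_on_def by blast
  have "l q = qpoch_inf (g q) (q ^ m)" if "q \<in> A" for q
  proof -
    have "norm (q ^ m) < 1" using q0(2)[OF that] r by (simp add: r_def)
    hence "(\<lambda>n. \<Prod>k\<le>n. 1 - g q * (q ^ m) ^ k) \<longlonglongrightarrow> qpoch_inf (g q) (q ^ m)"
      unfolding qpoch_inf_def
      by (intro convergent_prod_LIMSEQ convergent_prod_qpoch_inf)
    hence "(\<lambda>n. \<Prod>k<Suc n. 1 - g q * (q ^ m) ^ k) \<longlonglongrightarrow> qpoch_inf (g q) (q ^ m)"
      by (simp add: lessThan_Suc_atMost)
    hence "(\<lambda>n. \<Prod>k<n. 1 - g q * (q ^ m) ^ k) \<longlonglongrightarrow> qpoch_inf (g q) (q ^ m)"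
      by (rule LIMSEQ_imp_Suc)
    thus ?thesis
      using tendsto_uniform_limitI[OF l that] LIMSEQ_unique by blast
  qed
  hence "uniform_limit A (\<lambda>N q. \<Prod>k<N. 1 - g q * (q ^ m) ^ k)
           (\<lambda>q. qpoch_inf (g q) (q ^ m)) sequentially"
    using l by (subst uniform_limit_cong'[where g = "\<lambda>N q. \<Prod>k<N. 1 - g q * (q ^ m) ^ k" and i = l]) auto
  thus "\<exists>d>0. cball x d \<subseteq> ball 0 1 \<and>
          uniform_limit (cball x d) (\<lambda>N q. \<Prod>k<N. 1 - g q * (q ^ m) ^ k)
            (\<lambda>q. qpoch_inf (g q) (q ^ m)) sequentially"
    using d unfolding A_def by blast
qed

lemma qpoch_inf_list_holomorphic:
  assumes "\<And>g. g \<in> set gs \<Longrightarrow> g holomorphic_on ball 0 1" and "m > 0"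
  shows "(\<lambda>q. qpoch_inf_list (map (\<lambda>g. g q) gs) (q ^ m)) holomorphic_on ball 0 1"
  using assms(1)
  by (induction gs)
     (auto simp: qpoch_inf_list_def intro!: holomorphic_intros qpoch_inf_holomorphic \<open>m > 0\<close>)

lemma qproduct_has_fps_expansion:
  assumes "\<And>g. g \<in> set gs \<Longrightarrow> g holomorphic_on ball 0 1" "m > 0"
    and "\<And>h. h \<in> set hs \<Longrightarrow> h holomorphic_on ball 0 1" "n > 0"
  shows "\<exists>a. (\<lambda>q. qpoch_inf_list (map (\<lambda>g. g q) gs) (q ^ m) ^ i
               * qpoch_inf_list (map (\<lambda>h. h q) hs) (q ^ n) ^ j) has_fps_expansion Abs_fps a"
proof -
  have "(\<lambda>q. qpoch_inf_list (map (\<lambda>g. g q) gs) (q ^ m) ^ i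
           * qpoch_inf_list (map (\<lambda>h. h q) hs) (q ^ n) ^ j) holomorphic_on ball 0 1"
    by (intro holomorphic_intros qpoch_inf_list_holomorphic assms)
  from has_fps_expansion_fps_expansion[OF open_ball _ this] show ?thesis
    by (intro exI) (auto simp: fps_expansion_def)
qed

end

theory Submission
  imports Defs
begin

text \<open>
  Each of the seven products is a product of three theta functions, one of base \<open>q\<^sup>A\<close> and a square
  of one of base \<open>q\<^sup>B\<close>, with \<open>{A, B} = {5, 15}\<close>, up to a factor that depends on \<open>q\<^sup>5\<close> alone. By Jacobi's
  triple product (\<open>jacobi_triple_product\<close>) it therefore becomes, after multiplication by a
  nonvanishing function of \<open>q\<^sup>5\<close>, a sum over \<open>(x, y, z) \<in> \<int>\<^sup>3\<close> of terms \<open>(- 1)\<^sup>x (- \<epsilon>)\<^sup>y\<^sup>+\<^sup>z q\<^sup>E\<close>, where \<open>E\<close> is a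
  quadratic polynomial that is congruent to a linear form modulo \<open>5\<close> (\<open>triple_theta_product\<close>). Multiplying
  by a function of \<open>q\<^sup>5\<close> does not mix residue classes of exponents modulo \<open>5\<close>, so it suffices that
  the terms with \<open>E \<equiv> r\<close> modulo \<open>5\<close> cancel.

  They cancel in pairs (\<open>lattice_sum_residue_class_eq_0\<close>). The level sets of \<open>E\<close> are ellipsoids,
  and the reflection along the vector \<open>(p, 1, 1)\<close> preserves them, with \<open>p = 3\<close> if \<open>A = 5\<close> and
  \<open>p = 1\<close> or \<open>p = - 1\<close> if \<open>A = 15\<close>. It translates a point by a multiple of \<open>(p, 1, 1)\<close>, and for
  the listed residues \<open>r\<close> the congruence \<open>E \<equiv> r\<close> makes this multiple an odd integer. Then the
  reflection permutes the residue class, and it changes the sign of each term since \<open>x\<close> moves by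
  an odd and \<open>y + z\<close> by an even amount.

  Residue classes are separated analytically, by averaging over the fifth roots of unity
  (\<open>section_sum\<close>): the average vanishes on the punctured disc, so the coefficients in that class are
  zero by uniqueness of power series (\<open>fps_nth_eq_0_if_section_sum_eq_0\<close>).
\<close>

section \<open>Gaussian binomials and the finite triple product\<close>

text \<open>
  The Gaussian binomial coefficient, given by its Pascal rule so that it is a polynomial in \<open>q\<close>
  over any ring and vanishes for \<open>j > n\<close>.
\<close>
fun qbinom :: "'a::comm_ring_1 \<Rightarrow> nat \<Rightarrow> nat \<Rightarrow> 'a" where
  "qbinom q n 0 = 1"
| "qbinom q 0 (Suc j) = 0"
| "qbinom q (Suc n) (Suc j) = qbinom q n (Suc j) + q ^ (n - j) * qbinom q n j"

lemma qbinom_eq_0: "n < j \<Longrightarrow> qbinom q n j = 0"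
  by (induction q n j rule: qbinom.induct) auto

definition qpoch :: "'a::comm_ring_1 \<Rightarrow> 'a \<Rightarrow> nat \<Rightarrow> 'a" where
  "qpoch a q n = (\<Prod>k<n. 1 - a * q ^ k)"

lemma qpoch_0 [simp]: "qpoch a q 0 = 1"
  and qpoch_Suc: "qpoch a q (Suc n) = qpoch a q n * (1 - a * q ^ n)"
  by (simp_all add: qpoch_def)

text \<open>
  The closed form \<open>(q;q)\<^sub>n / ((q;q)\<^sub>j (q;q)\<^bsub>n-j\<^esub>)\<close> without division. In the induction the Pascal
  rule reduces to \<open>1 - q\<^sup>n\<^sup>+\<^sup>1 = (1 - q\<^sup>n\<^sup>-\<^sup>j) + q\<^sup>n\<^sup>-\<^sup>j (1 - q\<^sup>j\<^sup>+\<^sup>1)\<close>.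
\<close>
lemma qbinom_qpoch:
  "j \<le> n \<Longrightarrow> qbinom q n j * (qpoch q q j * qpoch q q (n - j)) = qpoch q q n"
proof (induction q n j rule: qbinom.induct)
  case (3 q n j)
  show ?case
  proof (cases "j = n")
    case True
    then show ?thesis using 3 by (simp add: qbinom_eq_0 qpoch_Suc algebra_simps)
  next
    case False
    with "3.prems" obtain d where n: "n = Suc (j + d)"
      by (metis Suc_le_mono le_neq_implies_less less_imp_Suc_add)
    define R where "R = qpoch q q (Suc j) * qpoch q q (Suc d)"
    have "qbinom q (Suc n) (Suc j) * R
          = qbinom q n (Suc j) * (qpoch q q (Suc j) * qpoch q q d) * (1 - q * q ^ d)
            + q ^ Suc d * (qbinom q n j * (qpoch q q j * qpoch q q (Suc d))) * (1 - q * q ^ j)"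
      by (simp add: R_def n qpoch_Suc algebra_simps)
    also have "qbinom q n (Suc j) * (qpoch q q (Suc j) * qpoch q q d) = qpoch q q n"
      using "3.IH"(1) by (simp add: n)
    also have "qbinom q n j * (qpoch q q j * qpoch q q (Suc d)) = qpoch q q n"
      using "3.IH"(2) by (simp add: n)
    also have "qpoch q q n * (1 - q * q ^ d) + q ^ Suc d * qpoch q q n * (1 - q * q ^ j)
                 = qpoch q q (Suc n)"
      by (simp add: qpoch_Suc n power_add algebra_simps)
    finally show ?thesis by (simp add: R_def n)
  qed
qed auto

text \<open>
  By induction on \<open>n\<close>: the new factor \<open>1 + x q\<^sup>n\<close> shifts the summation index by one, and
  \<open>q\<^sup>n q\<^bsup>binom(j,2)\<^esup> = q\<^sup>n\<^sup>-\<^sup>j q\<^bsup>binom(j+1,2)\<^esup>\<close> turns the two resulting coefficients into Pascal's rule.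
\<close>
theorem q_binomial_theorem:
  "(\<Prod>k<n. 1 + x * q ^ k) = (\<Sum>j\<le>n. qbinom q n j * q ^ (j choose 2) * x ^ j)"
proof (induction n)
  case (Suc n)
  have "(\<Prod>k<Suc n. 1 + x * q ^ k)
        = (\<Sum>j\<le>n. qbinom q n j * q ^ (j choose 2) * x ^ j)
          + (\<Sum>j\<le>n. q ^ n * x * (qbinom q n j * q ^ (j choose 2) * x ^ j))"
    by (simp add: Suc sum_distrib_left sum.distrib algebra_simps)
  also have "(\<Sum>j\<le>n. qbinom q n j * q ^ (j choose 2) * x ^ j)
               = (\<Sum>j\<le>Suc n. qbinom q n j * q ^ (j choose 2) * x ^ j)"
    by (simp add: qbinom_eq_0)
  also have "\<dots> = 1 + (\<Sum>j\<le>n. qbinom q n (Suc j) * q ^ (Suc j choose 2) * x ^ Suc j)"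
    by (subst sum.atMost_Suc_shift) (simp add: numeral_2_eq_2)
  also have "(\<Sum>j\<le>n. q ^ n * x * (qbinom q n j * q ^ (j choose 2) * x ^ j))
      = (\<Sum>j\<le>n. q ^ (n - j) * qbinom q n j * q ^ (Suc j choose 2) * x ^ Suc j)"
  proof (intro sum.cong refl)
    fix j assume "j \<in> {..n}"
    hence "q ^ n = q ^ (n - j) * q ^ j"
      by (simp flip: power_add)
    moreover have "q ^ (Suc j choose 2) = q ^ j * q ^ (j choose 2)"
      by (simp add: numeral_2_eq_2 power_add)
    ultimately show "q ^ n * x * (qbinom q n j * q ^ (j choose 2) * x ^ j)
      = q ^ (n - j) * qbinom q n j * q ^ (Suc j choose 2) * x ^ Suc j"
      by (simp add: mult_ac)
  qed
  also have "1 + (\<Sum>j\<le>n. qbinom q n (Suc j) * q ^ (Suc j choose 2) * x ^ Suc j) +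
      (\<Sum>j\<le>n. q ^ (n - j) * qbinom q n j * q ^ (Suc j choose 2) * x ^ Suc j)
      = (\<Sum>j\<le>Suc n. qbinom q (Suc n) j * q ^ (j choose 2) * x ^ j)"
    by (subst sum.atMost_Suc_shift) (simp add: numeral_2_eq_2 sum.distrib algebra_simps)
  finally show ?case .
qed (simp add: numeral_2_eq_2)

text \<open>
  The triangular exponent \<open>n (n - 1) / 2\<close> at an integer index; it continues \<open>n choose 2\<close>
  to negative \<open>n\<close>.
\<close>
definition tri :: "int \<Rightarrow> int" where "tri n = n * (n - 1) div 2"

lemma two_tri: "2 * tri n = n * (n - 1)"
  unfolding tri_def by simp

lemma choose_two_eq_tri: "int (j choose 2) = tri (int j)"
  by (cases j) (simp_all add: choose_two tri_def zdiv_int algebra_simps)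

text \<open>
  The \<open>q\<close>-binomial theorem for \<open>2 N\<close> factors at \<open>x = - z q\<^sup>-\<^sup>N\<close>. The upper \<open>N\<close> factors form
  \<open>(z;q)\<^sub>N\<close>. Each of the lower ones is \<open>1 - z q\<^sup>-\<^sup>k = (- z q\<^sup>-\<^sup>k) (1 - q\<^sup>k / z)\<close>, which gives
  \<open>(q/z;q)\<^sub>N\<close> and a monomial \<open>C\<close>; dividing by \<open>C\<close> recentres the sum at \<open>j = N\<close>.
\<close>
theorem finite_jacobi_triple:
  fixes q z :: "'a::field"
  assumes "q \<noteq> 0" "z \<noteq> 0"
  shows "qpoch z q N * qpoch (q / z) q N =
    (\<Sum>j\<le>2*N. qbinom q (2*N) j * ((- z) powi (int j - int N) * q powi tri (int j - int N)))"
proof -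
  define x where "x = - z / q ^ N"
  \<comment> \<open>\<open>C\<close> is the product of the monomials \<open>- z / q ^ k\<close> for \<open>k = 1, ..., N\<close>.\<close>
  define C where "C = (- z) powi (int N) * q powi (- tri (int N + 1))"
  have C: "C \<noteq> 0" using assms by (simp add: C_def)
  have low: "(\<Prod>k<N. 1 + x * q ^ k) = C * qpoch (q / z) q N"
  proof -
    have "(\<Prod>k<N. 1 + x * q ^ k) = (\<Prod>k<N. 1 + x * q ^ (N - Suc k))"
      by (rule prod.nat_diff_reindex [symmetric])
    also have "\<dots> = (\<Prod>k<N. 1 - z / q ^ Suc k)"
    proof (intro prod.cong refl)
      fix k assume "k \<in> {..<N}"
      hence "q ^ N = q ^ (N - Suc k) * q ^ Suc k"
        by (simp del: power_Suc flip: power_add)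
      thus "1 + x * q ^ (N - Suc k) = 1 - z / q ^ Suc k"
        using assms by (simp add: x_def del: power_Suc)
    qed
    also have "\<dots> = (\<Prod>k<N. (- z / q ^ Suc k) * (1 - q / z * q ^ k))"
      using assms by (intro prod.cong refl) (simp add: field_simps)
    also have "\<dots> = (\<Prod>k<N. - z / q ^ Suc k) * qpoch (q / z) q N"
      unfolding qpoch_def by (rule prod.distrib)
    also have "(\<Prod>k<N. - z / q ^ Suc k) = C"
      unfolding C_def
    proof (induction N)
      case (Suc N)
      have t: "- tri (int (Suc N) + 1) = - tri (int N + 1) - int (Suc N)"
        using two_tri[of "int (Suc N) + 1"] two_tri[of "int N + 1"] by (simp add: algebra_simps)
      show ?case
        unfolding prod.lessThan_Suc Suc t using assms
        by (simp add: power_int_diff power_int_add del: power_Suc)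
           (simp add: field_simps)
    qed (simp add: tri_def)
    finally show ?thesis .
  qed
  have split: "(\<Prod>k<m+n. f k) = (\<Prod>k<m. f k) * (\<Prod>k<n. f (m + k))" for f :: "nat \<Rightarrow> 'a" and m n
    by (induction n) (simp_all add: mult.assoc)
  have "(\<Prod>k<2*N. 1 + x * q ^ k) = (\<Prod>k<N. 1 + x * q ^ k) * (\<Prod>k<N. 1 + x * q ^ (N + k))"
    using split[of "\<lambda>k. 1 + x * q ^ k" N N] by (simp add: mult_2)
  also have "(\<Prod>k<N. 1 + x * q ^ (N + k)) = qpoch z q N"
    using assms unfolding qpoch_def by (intro prod.cong refl) (simp add: x_def power_add)
  also note low
  finally have "C * (qpoch z q N * qpoch (q / z) q N) = (\<Prod>k<2*N. 1 + x * q ^ k)"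
    by (simp add: mult_ac)
  also have "\<dots> = (\<Sum>j\<le>2*N. qbinom q (2*N) j * q ^ (j choose 2) * x ^ j)"
    by (rule q_binomial_theorem)
  also have "\<dots> = (\<Sum>j\<le>2*N. C * (qbinom q (2*N) j *
                 ((- z) powi (int j - int N) * q powi tri (int j - int N))))"
  proof (intro sum.cong refl)
    fix j
    have "x ^ j = (- z) ^ j / q ^ (N * j)"
      by (simp only: x_def power_divide power_mult)
    hence "q ^ (j choose 2) * x ^ j = (- z) powi (int j) * q powi (tri (int j) - int N * int j)"
      using assms by (simp add: power_int_diff flip: choose_two_eq_tri of_nat_mult)
    also have "tri (int j) - int N * int j = - tri (int N + 1) + tri (int j - int N)"
      using two_tri[of "int j"] two_tri[of "int N + 1"] two_tri[of "int j - int N"]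
      by (simp add: algebra_simps)
    also have "(- z) powi (int j) * q powi \<dots> = 
       ((- z) powi (int N) * (- z) powi (int j - int N)) * (q powi (- tri (int N + 1)) * q powi tri (int j - int N))"
      using assms by (subst (1 2) power_int_add [symmetric]) auto
    finally show "qbinom q (2*N) j * q ^ (j choose 2) * x ^ j =
      C * (qbinom q (2*N) j * ((- z) powi (int j - int N) * q powi tri (int j - int N)))"
      by (simp add: C_def mult_ac)
  qed
  also have "\<dots> = C * (\<Sum>j\<le>2*N. qbinom q (2*N) j *
                 ((- z) powi (int j - int N) * q powi tri (int j - int N)))"
    by (simp add: sum_distrib_left)
  finally show ?thesis using C by simp
qed

section \<open>Jacobi's triple product\<close>

lemma qpoch_tendsto:
  assumes "norm q < 1"
  shows "qpoch a q \<longlonglongrightarrow> qpoch_inf a q"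
proof -
  have "(\<lambda>n. \<Prod>k\<le>n. 1 - a * q ^ k) \<longlonglongrightarrow> qpoch_inf a q"
    unfolding qpoch_inf_def
    by (intro convergent_prod_LIMSEQ convergent_prod_qpoch_inf assms)
  thus ?thesis
    unfolding qpoch_def by (subst LIMSEQ_lessThan_iff_atMost)
qed

lemma power_neq_1:
  fixes q :: complex
  assumes "norm q < 1"
  shows "q ^ Suc k \<noteq> 1"
proof
  assume "q ^ Suc k = 1"
  hence "norm q ^ Suc k = 1" by (metis norm_one norm_power)
  thus False using power_less_one_iff[of "norm q" "Suc k"] assms by simp
qed

lemma qpoch_self_nonzero:
  fixes q :: complex
  assumes "norm q < 1"
  shows "qpoch q q n \<noteq> 0"
  using power_neq_1[OF assms] by (auto simp: qpoch_def)

lemma qpoch_inf_self_nonzero: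
  assumes "norm q < 1"
  shows "qpoch_inf q q \<noteq> 0"
proof -
  have "(\<lambda>k. 1 - q * q ^ k) has_prod qpoch_inf q q"
    unfolding qpoch_inf_def
    by (rule convergent_prod_has_prod[OF convergent_prod_qpoch_inf[OF assms]])
  hence "qpoch_inf q q = 0 \<longleftrightarrow> (\<exists>k. q * q ^ k = 1)"
    by (subst has_prod_eq_0_iff) auto
  thus ?thesis
    using power_neq_1[OF assms] by (metis power_Suc)
qed

definition theta_term :: "complex \<Rightarrow> complex \<Rightarrow> int \<Rightarrow> complex" where
  "theta_term z q n = (- z) powi n * q powi tri n"

text \<open>
  Ratio test: consecutive terms have ratio \<open>w q\<^sup>n\<close>, which tends to \<open>0\<close>. Both halves of a theta
  series have this shape, with \<open>w = - z\<close> for indices \<open>n \<ge> 0\<close> and \<open>w = - q / z\<close> for indices \<open>n \<le> 0\<close>.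
\<close>
lemma summable_theta_half:
  fixes q w :: complex
  assumes "norm q < 1"
  shows "summable (\<lambda>n. norm (w ^ n * q ^ (n choose 2)))"
proof -
  have "(\<lambda>n. norm w * norm q ^ n) \<longlonglongrightarrow> norm w * 0"
    using assms by (intro tendsto_intros LIMSEQ_power_zero) auto
  hence "eventually (\<lambda>n. norm w * norm q ^ n < 1/2) sequentially"
    by (rule order_tendstoD) auto
  then obtain N where N: "\<And>n. n \<ge> N \<Longrightarrow> norm w * norm q ^ n < 1/2"
    by (auto simp: eventually_at_top_linorder)
  show ?thesis
  proof (rule summable_ratio_test)
    fix n assume "n \<ge> N"
    have "norm (norm (w ^ Suc n * q ^ (Suc n choose 2))) =
            (norm w * norm q ^ n) * norm (norm (w ^ n * q ^ (n choose 2)))"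
      by (simp add: norm_mult norm_power numeral_2_eq_2 power_add)
    also have "\<dots> \<le> 1/2 * norm (norm (w ^ n * q ^ (n choose 2)))"
      using N[OF \<open>n \<ge> N\<close>] by (intro mult_right_mono) auto
    finally show "norm (norm (w ^ Suc n * q ^ (Suc n choose 2))) \<le>
      1/2 * norm (norm (w ^ n * q ^ (n choose 2)))" .
  qed simp
qed

lemma abs_summable_theta_term:
  assumes "q \<noteq> 0" "norm q < 1" "z \<noteq> 0"
  shows "Infinite_Set_Sum.abs_summable_on (theta_term z q) UNIV"
proof -
  have "theta_term z q (int n) = (- z) ^ n * q ^ (n choose 2)" for n
    by (simp add: theta_term_def flip: choose_two_eq_tri)
  hence pos: "Infinite_Set_Sum.abs_summable_on (theta_term z q) (range int)"
    using summable_theta_half[OF assms(2), of "- z"]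
    by (intro abs_summable_on_reindex) (simp add: abs_summable_on_nat_iff')
  have "theta_term z q (- int n) = (- q / z) ^ n * q ^ (n choose 2)" for n
  proof -
    have "tri (- int n) = int (n choose 2) + int n"
      using two_tri[of "- int n"] two_tri[of "int n"]
      by (simp add: choose_two_eq_tri algebra_simps)
    hence "theta_term z q (- int n) = inverse ((- z) ^ n) * (q ^ (n choose 2) * q ^ n)"
      using assms by (simp add: theta_term_def power_int_add power_int_minus)
    also have "\<dots> = (q / (- z)) ^ n * q ^ (n choose 2)"
      unfolding power_divide by (simp only: divide_inverse mult_ac)
    also have "q / (- z) = - q / z" by simp
    finally show ?thesis .
  qed
  hence neg: "Infinite_Set_Sum.abs_summable_on (theta_term z q) (range (\<lambda>n. - int n))"
    using summable_theta_half[OF assms(2), of "- q / z"]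
    by (intro abs_summable_on_reindex) (simp add: abs_summable_on_nat_iff')
  have "UNIV = range int \<union> range (\<lambda>n. - int n)"
    by (auto simp: image_iff) (metis int_cases2)
  with abs_summable_on_union[OF pos neg] show ?thesis by simp
qed

text \<open>
  The limit \<open>N \<rightarrow> \<infinity>\<close> of the finite identity. Each Gaussian binomial tends to \<open>1 / (q;q)\<^sub>\<infinity>\<close>. They
  are uniformly bounded, since \<open>(q;q)\<^sub>n\<close> and its inverse converge, so dominated convergence on
  the integers with counting measure permits taking the limit termwise.
\<close>
theorem jacobi_triple_product:
  assumes q: "q \<noteq> 0" "norm q < 1" and z: "z \<noteq> 0"
  shows "infsetsum (theta_term z q) UNIV
           = qpoch_inf z q * qpoch_inf (q / z) q * qpoch_inf q q"
proof -
  define P where "P = qpoch_inf q q"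
  have P: "P \<noteq> 0" "qpoch q q \<longlonglongrightarrow> P"
    unfolding P_def by (rule qpoch_inf_self_nonzero q qpoch_tendsto)+
  define c where "c = (\<lambda>N n. if \<bar>n\<bar> \<le> int N then qbinom q (2*N) (nat (int N + n)) else 0)"
  have c_eq: "c N n = qpoch q q (2 * N) *
      (inverse (qpoch q q (nat (int N + n))) * inverse (qpoch q q (nat (int N - n))))"
    if "\<bar>n\<bar> \<le> int N" for N n
  proof -
    have "2 * N - nat (int N + n) = nat (int N - n)" using that by linarith
    with qbinom_qpoch[of "nat (int N + n)" "2 * N" q] that qpoch_self_nonzero[OF q(2)]
    show ?thesis by (simp add: c_def field_simps)
  qed
  have finite: "infsetsum (\<lambda>n. c N n * theta_term z q n) UNIV = qpoch z q N * qpoch (q / z) q N" for N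
  proof -
    have "infsetsum (\<lambda>n. c N n * theta_term z q n) UNIV
            = infsetsum (\<lambda>n. c N n * theta_term z q n) {- int N..int N}"
      by (rule infsetsum_cong_neutral) (auto simp: c_def)
    also have "\<dots> = (\<Sum>n\<in>{- int N..int N}. c N n * theta_term z q n)"
      by simp
    also have "\<dots> = (\<Sum>j\<le>2*N. qbinom q (2*N) j * ((- z) powi (int j - int N) * q powi tri (int j - int N)))"
      by (rule sum.reindex_bij_witness[of _ "\<lambda>j. int j - int N" "\<lambda>n. nat (int N + n)"])
         (auto simp: c_def theta_term_def)
    also have "\<dots> = qpoch z q N * qpoch (q / z) q N"
      using finite_jacobi_triple[of q z N] q z by simp
    finally show ?thesis .
  qed
  obtain K where K: "\<And>N n. norm (c N n) \<le> K"
  proof -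
    have "Bseq (qpoch q q)" "Bseq (\<lambda>n. inverse (qpoch q q n))"
      using P by (auto intro!: convergent_imp_Bseq convergentI tendsto_inverse)
    then obtain K1 K2 where K12: "K1 > 0" "\<And>n. norm (qpoch q q n) \<le> K1"
        "K2 > 0" "\<And>n. norm (inverse (qpoch q q n)) \<le> K2"
      by (meson BseqE)
    have "norm (c N n) \<le> K1 * (K2 * K2)" for N n
    proof (cases "\<bar>n\<bar> \<le> int N")
      case True
      show ?thesis
        unfolding c_eq[OF True] norm_mult using K12 by (intro mult_mono) auto
    qed (use K12 in \<open>auto simp: c_def\<close>)
    thus ?thesis by (rule that)
  qed
  have lim: "(\<lambda>N. c N n) \<longlonglongrightarrow> inverse P" for n
  proof -
    have "filterlim (\<lambda>N. 2 * N) at_top (sequentially :: nat filter)"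
         "filterlim (\<lambda>N. nat (int N + n)) at_top sequentially"
         "filterlim (\<lambda>N. nat (int N - n)) at_top sequentially"
      by real_asymp+
    note L = this[THEN filterlim_compose[OF P(2)]]
    have "(\<lambda>N. qpoch q q (2 * N) * (inverse (qpoch q q (nat (int N + n))) *
             inverse (qpoch q q (nat (int N - n))))) \<longlonglongrightarrow> P * (inverse P * inverse P)"
      by (intro tendsto_intros L P)
    moreover have "eventually (\<lambda>N. \<bar>n\<bar> \<le> int N) sequentially"
      using eventually_ge_at_top[of "nat \<bar>n\<bar>"] by eventually_elim linarith
    hence "eventually (\<lambda>N. qpoch q q (2 * N) * (inverse (qpoch q q (nat (int N + n))) *
             inverse (qpoch q q (nat (int N - n)))) = c N n) sequentially"
      by eventually_elim (rule c_eq[symmetric])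
    ultimately have "(\<lambda>N. c N n) \<longlonglongrightarrow> P * (inverse P * inverse P)"
      by (rule Lim_transform_eventually)
    moreover have "P * (inverse P * inverse P) = inverse P" using P(1) by simp
    ultimately show ?thesis by (simp only:)
  qed
  have summ: "Infinite_Set_Sum.abs_summable_on (theta_term z q) UNIV"
    by (rule abs_summable_theta_term) fact+
  have "(\<lambda>N. infsetsum (\<lambda>n. c N n * theta_term z q n) UNIV)
          \<longlonglongrightarrow> infsetsum (\<lambda>n. inverse P * theta_term z q n) UNIV"
    unfolding infsetsum_def
  proof (rule integral_dominated_convergence)
    show "integrable (count_space UNIV) (\<lambda>n. K * norm (theta_term z q n))"
      using summ unfolding abs_summable_on_def by simp
    show "AE n in count_space UNIV. norm (c N n * theta_term z q n) \<le> K * norm (theta_term z q n)" for N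
      by (auto simp: norm_mult intro!: mult_right_mono K)
    show "AE n in count_space UNIV. (\<lambda>N. c N n * theta_term z q n) \<longlonglongrightarrow> inverse P * theta_term z q n"
      by (auto intro!: tendsto_intros lim)
  qed simp_all
  moreover have "infsetsum (\<lambda>n. inverse P * theta_term z q n) UNIV = inverse P * infsetsum (theta_term z q) UNIV"
    by (intro infsetsum_cmult_right summ)
  moreover have "(\<lambda>N. qpoch z q N * qpoch (q / z) q N) \<longlonglongrightarrow> qpoch_inf z q * qpoch_inf (q / z) q"
    by (intro tendsto_intros qpoch_tendsto q)
  ultimately have "inverse P * infsetsum (theta_term z q) UNIV = qpoch_inf z q * qpoch_inf (q / z) q"
    by (simp add: finite LIMSEQ_unique)
  thus ?thesis using P(1) by (simp add: P_def field_simps)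
qed

section \<open>Residue classes of coefficients\<close>

lemma cis_root_powi_eq_1_iff:
  assumes "m > 0"
  shows "cis (2 * pi / real m) powi k = 1 \<longleftrightarrow> int m dvd k"
proof -
  have "cis (2 * pi / real m) powi k = 1 \<longleftrightarrow> (\<exists>n. of_int k * (2 * pi / real m) = of_int n * (2 * pi))"
    unfolding cis_power_int unfolding cis_conv_exp exp_eq_1 by (simp add: mult_ac)
  also have "\<dots> \<longleftrightarrow> (\<exists>n. real_of_int k = of_int (int m * n))"
    using assms by (simp add: field_simps)
  also have "\<dots> \<longleftrightarrow> int m dvd k"
    unfolding of_int_eq_iff dvd_def ..
  finally show ?thesis .
qed

lemma sum_roots_of_unity_powi:
  assumes "m > 0"
  shows "(\<Sum>j<m. (cis (2 * pi / real m) ^ j) powi k) = (if int m dvd k then of_nat m else 0)"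
proof -
  define u where "u = cis (2 * pi / real m) powi k"
  have "(\<Sum>j<m. (cis (2 * pi / real m) ^ j) powi k) = (\<Sum>j<m. u ^ j)"
    unfolding u_def by (simp only: power_int_power power_int_power' mult.commute)
  moreover have "(\<Sum>j<m. u ^ j) = 0" if "u \<noteq> 1"
  proof -
    have "u ^ m = (cis (2 * pi / real m) ^ m) powi k"
      unfolding u_def by (simp only: power_int_power power_int_power' mult.commute)
    also have "cis (2 * pi / real m) ^ m = 1"
      using assms by (simp add: Complex.DeMoivre)
    finally have "u ^ m = 1" by simp
    thus ?thesis using that by (simp add: sum_gp_strict)
  qed
  moreover have "u = 1 \<longleftrightarrow> int m dvd k"
    unfolding u_def by (rule cis_root_powi_eq_1_iff[OF assms])
  ultimately show ?thesis by auto
qed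

text \<open>
  The roots of unity filter. If \<open>f\<close> is the sum of a power series that converges absolutely at \<open>q\<close>, this
  is \<open>m\<close> times the sum of the terms whose degree is congruent to \<open>r\<close> modulo \<open>m\<close>.
\<close>
definition section_sum :: "nat \<Rightarrow> int \<Rightarrow> (complex \<Rightarrow> complex) \<Rightarrow> complex \<Rightarrow> complex" where
  "section_sum m r f q = (\<Sum>j<m. (cis (2 * pi / real m) ^ j) powi (- r) * f (cis (2 * pi / real m) ^ j * q))"

text \<open>
  The filter multiplies the coefficient of degree \<open>n \<equiv> r\<close> by \<open>m\<close>, and the power series of the
  zero function is unique. If \<open>m\<close> does not divide \<open>r\<close> the filter vanishes at the origin for every \<open>f\<close>, so
  vanishing for \<open>q \<noteq> 0\<close> suffices; this is the range in which the triple product can be used, as its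
  parameter \<open>z = e q\<^sup>i\<close> must not be zero.
\<close>
lemma fps_nth_eq_0_if_section_sum_eq_0:
  assumes f: "f has_fps_expansion F" and m: "m > 0"
    and zero: "\<And>q. q \<noteq> 0 \<Longrightarrow> norm q < 1 \<Longrightarrow> section_sum m r f q = 0"
    and r: "\<not> int m dvd r"
    and n: "int m dvd int n - r"
  shows "fps_nth F n = 0"
proof -
  define w where "w = cis (2 * pi / real m)"
  have "section_sum m r f 0 = (\<Sum>j<m. (w ^ j) powi (- r)) * f 0"
    by (simp add: section_sum_def w_def sum_distrib_right)
  also have "\<dots> = 0"
    using r by (simp add: w_def sum_roots_of_unity_powi[OF m])
  finally have zero': "section_sum m r f q = 0" if "norm q < 1" for q
    using zero[of q] that by (cases "q = 0") auto
  have "eventually (\<lambda>q. q \<in> ball 0 1) (nhds (0::complex))"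
    by (intro eventually_nhds_in_open) auto
  hence ev: "eventually (\<lambda>q. section_sum m r f q = 0) (nhds 0)"
    by eventually_elim (auto intro: zero')
  define G where "G = (\<Sum>j<m. fps_const ((w ^ j) powi (- r)) * fps_compose F (fps_const (w ^ j) * fps_X))"
  have "(\<lambda>q. \<Sum>j<m. (w ^ j) powi (- r) * (f \<circ> (\<lambda>q. w ^ j * q)) q) has_fps_expansion G"
    unfolding G_def by (intro fps_expansion_intros f) auto
  hence "section_sum m r f has_fps_expansion G"
    by (simp add: section_sum_def[abs_def] w_def)
  also have "?this \<longleftrightarrow> (\<lambda>_. 0) has_fps_expansion G"
    by (rule has_fps_expansion_cong) (use ev in auto)
  finally have "G = 0"
    using fps_expansion_unique_complex has_fps_expansion_0 by blast
  hence "0 = fps_nth G n" by simp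
  also have "fps_nth G n = (\<Sum>j<m. (w ^ j) powi (- r) * ((w ^ j) ^ n * fps_nth F n))"
    by (simp add: G_def fps_sum_nth fps_compose_linear)
  also have "\<dots> = (\<Sum>j<m. (w ^ j) powi (int n - r)) * fps_nth F n"
    unfolding sum_distrib_right
    by (intro sum.cong refl) (simp add: w_def power_int_diff power_int_minus divide_inverse)
  also have "\<dots> = of_nat m * fps_nth F n"
    using n by (simp add: w_def sum_roots_of_unity_powi[OF m])
  finally show ?thesis using m by simp
qed

lemma infsetsum_eq_0_sign_reversing:
  fixes f :: "'a \<Rightarrow> complex"
  assumes "bij_betw \<phi> S S" "\<And>v. v \<in> S \<Longrightarrow> f (\<phi> v) = - f v"
  shows "infsetsum f S = 0"
proof -
  have "infsetsum f S = infsetsum (\<lambda>v. f (\<phi> v)) S"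
    by (rule infsetsum_reindex_bij_betw[OF assms(1), symmetric])
  also have "\<dots> = infsetsum (\<lambda>v. - f v) S"
    by (rule infsetsum_cong) (use assms(2) in auto)
  also have "\<dots> = - infsetsum f S" by (rule infsetsum_uminus)
  finally show ?thesis by simp
qed

section \<open>The product of three theta functions as a lattice sum\<close>

lemma theta_term_monomial:
  assumes "q \<noteq> 0"
  shows "theta_term (e * q ^ i) (q ^ m) n = (- e) powi n * q powi (int m * tri n + int i * n)"
proof -
  have "(- (e * q ^ i)) powi n = (- e) powi n * q powi (int i * n)"
    by (simp only: mult_minus_left[symmetric] power_int_mult_distrib power_int_power)
  thus ?thesis using assms
    by (simp add: theta_term_def power_int_power power_int_add)
qed

text \<open>
  As \<open>e = 1/e\<close>, the two factors \<open>z = e q\<^sup>i\<close> and \<open>q\<^sup>m / z = e q\<^sup>m\<^sup>-\<^sup>i\<close> of the triple product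
  with base \<open>q\<^sup>m\<close> carry the same sign \<open>e\<close>.
\<close>
lemma theta_product:
  assumes q: "q \<noteq> 0" "norm q < 1" and e: "e \<in> {1, -1}" and i: "i \<le> m" "m > 0"
  shows "infsetsum (theta_term (e * q ^ i) (q ^ m)) UNIV
         = qpoch_inf_list [e * q ^ i, e * q ^ (m - i)] (q ^ m) * qpoch_inf (q ^ m) (q ^ m)"
    and "Infinite_Set_Sum.abs_summable_on (theta_term (e * q ^ i) (q ^ m)) UNIV"
proof -
  have qm: "q ^ m \<noteq> 0" "norm (q ^ m) < 1" "e * q ^ i \<noteq> 0"
    using q i e by (auto simp: norm_power power_less_one_iff)
  have "q ^ m = q ^ (m - i) * q ^ i" using i by (simp flip: power_add)
  hence "q ^ m / (e * q ^ i) = e * q ^ (m - i)"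
    using q e by (auto simp: field_simps)
  thus "infsetsum (theta_term (e * q ^ i) (q ^ m)) UNIV
         = qpoch_inf_list [e * q ^ i, e * q ^ (m - i)] (q ^ m) * qpoch_inf (q ^ m) (q ^ m)"
    using jacobi_triple_product[OF qm] by (simp add: qpoch_inf_list_def)
  show "Infinite_Set_Sum.abs_summable_on (theta_term (e * q ^ i) (q ^ m)) UNIV"
    by (rule abs_summable_theta_term) fact+
qed

definition lattice_exponent :: "nat \<Rightarrow> nat \<Rightarrow> nat \<Rightarrow> nat \<Rightarrow> int \<times> int \<times> int \<Rightarrow> int" where
  "lattice_exponent A a B b = (\<lambda>(x, y, z).
     int A * tri x + int B * (tri y + tri z) + int a * x + int b * (y + z))"

definition lattice_sign :: "complex \<Rightarrow> int \<times> int \<times> int \<Rightarrow> complex" where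
  "lattice_sign e = (\<lambda>(x, y, z). (- 1) powi x * (- e) powi (y + z))"

lemma triple_theta_product:
  assumes q: "q \<noteq> 0" "norm q < 1" and e: "e \<in> {1, -1}"
    and ab: "a \<le> A" "A > 0" "b \<le> B" "B > 0"
  defines "h \<equiv> (\<lambda>v. lattice_sign e v * q powi lattice_exponent A a B b v)"
  shows "Infinite_Set_Sum.abs_summable_on h UNIV" (is ?sum)
    and "qpoch_inf_list [q ^ a, q ^ (A - a)] (q ^ A)
         * (qpoch_inf_list [e * q ^ b, e * q ^ (B - b)] (q ^ B))\<^sup>2
         * (qpoch_inf (q ^ A) (q ^ A) * (qpoch_inf (q ^ B) (q ^ B))\<^sup>2)
         = infsetsum h UNIV" (is ?eq)
proof -
  define s t where "s = theta_term (1 * q ^ a) (q ^ A)" and "t = theta_term (e * q ^ b) (q ^ B)"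
  have st: "Infinite_Set_Sum.abs_summable_on s UNIV" "Infinite_Set_Sum.abs_summable_on t UNIV"
    unfolding s_def t_def by (rule theta_product(2); use assms in simp)+
  have e0: "- e \<noteq> 0" using e by auto
  have h: "h = (\<lambda>(x, v). s x * (case v of (y, z) \<Rightarrow> t y * t z))"
    using q e0 by (auto simp: h_def s_def t_def fun_eq_iff lattice_sign_def lattice_exponent_def
           theta_term_monomial[OF q(1), of 1, simplified] theta_term_monomial[OF q(1), of e] 
           power_int_add algebra_simps)
  have tt: "Infinite_Set_Sum.abs_summable_on (\<lambda>(y, z). t y * t z) UNIV"
    "infsetsum (\<lambda>(y, z). t y * t z) UNIV = infsetsum t UNIV * infsetsum t UNIV"
    using abs_summable_on_product[OF _ _ st(2) st(2)] infsetsum_product[OF _ _ st(2) st(2)]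
    by (simp_all add: UNIV_Times_UNIV)
  show ?sum
    using abs_summable_on_product[OF _ _ st(1) tt(1)] by (simp add: h UNIV_Times_UNIV)
  have "infsetsum h UNIV = infsetsum s UNIV * (infsetsum t UNIV * infsetsum t UNIV)"
    using infsetsum_product[OF _ _ st(1) tt(1)] by (simp add: h tt(2) UNIV_Times_UNIV)
  also have "infsetsum s UNIV = qpoch_inf_list [q ^ a, q ^ (A - a)] (q ^ A) * qpoch_inf (q ^ A) (q ^ A)"
    using theta_product(1)[OF q, of 1 a A] ab by (simp add: s_def)
  also have "infsetsum t UNIV = qpoch_inf_list [e * q ^ b, e * q ^ (B - b)] (q ^ B) * qpoch_inf (q ^ B) (q ^ B)"
    unfolding t_def using ab e by (intro theta_product(1) q)
  finally show ?eq by (simp add: power2_eq_square mult_ac)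
qed

section \<open>The sign-reversing reflection\<close>

text \<open>
  Completing squares, the exponent is half of \<open>A X\<^sup>2 + B Y\<^sup>2 + B Z\<^sup>2\<close> up to a constant, where \<open>X, Y, Z\<close>
  are translates of \<open>x, y, z\<close>. Reflection in the plane orthogonal to \<open>(p, 1, 1)\<close> for this form
  preserves it. The reflection moves \<open>(x, y, z)\<close> by \<open>-k (p, 1, 1)\<close>, where
  \<open>k = (2 A p x + 2 B (y + z) + \<kappa>) / N\<close>; here \<open>N = A p\<^sup>2 + 2 B\<close> is the value of the form at
  \<open>(p, 1, 1)\<close>, and \<open>\<kappa>\<close> collects the contributions of the translations.

  On the chosen residue class \<open>k\<close> is an odd integer, so the reflection maps the class to itself. Since
  \<open>p k\<close> is odd it flips \<open>(- 1) powi x\<close>, while \<open>y + z\<close> changes by the even number \<open>2 k\<close>. Terms of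
  the lattice sum therefore cancel in pairs; no point is fixed because \<open>k \<noteq> 0\<close>.
\<close>
lemma lattice_sum_residue_class_eq_0:
  fixes p r :: int and a A b B m :: nat
  assumes q: "q \<noteq> 0" and e: "e \<in> {1, -1}"
    and AB: "A > 0" "int m dvd int A" "int m dvd int B" and p: "odd p"
  defines "N \<equiv> int A * p\<^sup>2 + 2 * int B"
  defines "\<kappa> \<equiv> 2 * int a * p - int A * p + 4 * int b - 2 * int B"
  assumes odd_multiple: "\<And>x w. int m dvd int a * x + int b * w - r \<Longrightarrow>
            \<exists>k. odd k \<and> 2 * int A * p * x + 2 * int B * w + \<kappa> = N * k"
  shows "infsetsum (\<lambda>v. lattice_sign e v * q powi lattice_exponent A a B b v)
           {v. int m dvd lattice_exponent A a B b v - r} = 0"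
proof -
  define S where "S = {v. int m dvd lattice_exponent A a B b v - r}"
  define k where "k = (\<lambda>(x, y, z). (2 * int A * p * x + 2 * int B * (y + z) + \<kappa>) div N)"
  define \<phi> where "\<phi> = (\<lambda>v. case v of (x, y, z) \<Rightarrow> (x - p * k v, y - k v, z - k v))"
  have "p \<noteq> 0" using p by auto
  hence N: "N > 0" using AB(1) by (simp add: N_def add_pos_nonneg)
  \<comment> \<open>Modulo \<open>m\<close> the triangular terms of the exponent vanish, leaving the linear form of the hypothesis.\<close>
  have k: "odd (k (x, y, z))" "2 * int A * p * x + 2 * int B * (y + z) + \<kappa> = N * k (x, y, z)"
    if "(x, y, z) \<in> S" for x y z
  proof -
    have "int m dvd int A * tri x + int B * (tri y + tri z)"
      using AB by auto
    hence "int m dvd (int A * tri x + int B * (tri y + tri z)) + (int a * x + int b * (y + z) - r)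
             \<longleftrightarrow> int m dvd int a * x + int b * (y + z) - r"
      by (rule dvd_add_right_iff)
    hence "int m dvd int a * x + int b * (y + z) - r"
      using that by (simp add: S_def lattice_exponent_def algebra_simps)
    from odd_multiple[OF this] N
    show "odd (k (x, y, z))" "2 * int A * p * x + 2 * int B * (y + z) + \<kappa> = N * k (x, y, z)"
      by (auto simp: k_def)
  qed
  have exponent: "lattice_exponent A a B b (\<phi> v) = lattice_exponent A a B b v" if "v \<in> S" for v
  proof -
    obtain x y z where v: "v = (x, y, z)" by (cases v) auto
    define K where "K = k v"
    have K: "2 * int A * p * x + 2 * int B * (y + z) + \<kappa> = N * K"
      using k(2) that by (simp add: v K_def)
    have E: "2 * lattice_exponent A a B b (x, y, z) = int A * (x * (x - 1)) + int B * (y * (y - 1) + z * (z - 1))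
               + 2 * int a * x + 2 * int b * (y + z)" for x y z
      unfolding two_tri [symmetric] by (simp add: lattice_exponent_def algebra_simps)
    have "2 * lattice_exponent A a B b (\<phi> v) = 2 * lattice_exponent A a B b v
           - K * (2 * int A * p * x + 2 * int B * (y + z) + \<kappa> - N * K)"
      by (simp add: v \<phi>_def E N_def \<kappa>_def K_def algebra_simps power2_eq_square)
    thus ?thesis using K by simp
  qed
  have k_neg: "k (\<phi> v) = - k v" if "v \<in> S" for v
  proof -
    obtain x y z where v: "v = (x, y, z)" by (cases v) auto
    have "2 * int A * p * (x - p * k v) + 2 * int B * (y - k v + (z - k v)) + \<kappa>
            = N * k v - 2 * N * k v"
      using k(2)[of x y z] that by (simp add: v N_def algebra_simps power2_eq_square)
    also have "\<dots> = N * (- k v)" by simp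
    finally show ?thesis using N by (simp add: v \<phi>_def k_def del: mult_minus_right)
  qed
  have S: "\<phi> v \<in> S" if "v \<in> S" for v
    using that exponent[OF that] by (simp add: S_def)
  have inv: "\<phi> (\<phi> v) = v" if "v \<in> S" for v
    using k_neg[OF that] by (cases v) (simp add: \<phi>_def)
  have bij: "bij_betw \<phi> S S"
    by (rule bij_betwI[of _ _ _ \<phi>]) (use S inv in auto)
  have sign: "lattice_sign e (\<phi> v) = - lattice_sign e v" if "v \<in> S" for v
  proof -
    obtain x y z where v: "v = (x, y, z)" by (cases v) auto
    have "odd (p * k v)" using p k(1) that by (simp add: v)
    moreover have "y - k v + (z - k v) = (y + z) - 2 * k v" by simp
    ultimately show ?thesis
      using e by (auto simp: v \<phi>_def lattice_sign_def power_int_diff power_int_minus_left)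
  qed
  show ?thesis
    using infsetsum_eq_0_sign_reversing[OF bij, of "\<lambda>v. lattice_sign e v * q powi lattice_exponent A a B b v"]
    by (simp add: sign exponent S_def)
qed

text \<open>
  The product times \<open>D = (q\<^sup>A;q\<^sup>A)\<^sub>\<infinity> (q\<^sup>B;q\<^sup>B)\<^sub>\<infinity>\<^sup>2\<close> is the lattice sum. As \<open>D\<close> depends only on \<open>q\<^sup>m\<close> it
  commutes with the filter, and it does not vanish in the unit disc, so it can be cancelled after
  the filter has reduced the lattice sum to a residue class.
\<close>
lemma section_sum_theta_product_eq_0:
  fixes p r :: int and a A b B m :: nat
  assumes q: "q \<noteq> 0" "norm q < 1" and e: "e \<in> {1, -1}" and m: "m > 0"
    and ab: "a \<le> A" "A > 0" "b \<le> B" "B > 0" and dvd: "m dvd A" "m dvd B" and p: "odd p"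
    and odd_multiple: "\<And>x w. int m dvd int a * x + int b * w - r \<Longrightarrow>
            \<exists>k. odd k \<and> 2 * int A * p * x + 2 * int B * w
                  + (2 * int a * p - int A * p + 4 * int b - 2 * int B)
                  = (int A * p\<^sup>2 + 2 * int B) * k"
  shows "section_sum m r (\<lambda>q. qpoch_inf_list [q ^ a, q ^ (A - a)] (q ^ A)
           * (qpoch_inf_list [e * q ^ b, e * q ^ (B - b)] (q ^ B))\<^sup>2) q = 0"
proof -
  define F where "F = (\<lambda>q. qpoch_inf_list [q ^ a, q ^ (A - a)] (q ^ A)
           * (qpoch_inf_list [e * q ^ b, e * q ^ (B - b)] (q ^ B))\<^sup>2)"
  define D where "D = qpoch_inf (q ^ A) (q ^ A) * (qpoch_inf (q ^ B) (q ^ B))\<^sup>2"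
  define E where "E = lattice_exponent A a B b"
  define w where "w = cis (2 * pi / real m)"
  have w: "w \<noteq> 0" "norm w = 1" "w ^ m = 1"
    using m by (simp_all add: w_def Complex.DeMoivre)
  have D: "D \<noteq> 0"
    using qpoch_inf_self_nonzero[of "q ^ A"] qpoch_inf_self_nonzero[of "q ^ B"] q ab
    by (simp add: D_def norm_power power_less_one_iff)
  have summ: "Infinite_Set_Sum.abs_summable_on (\<lambda>v. lattice_sign e v * (w ^ j * q) powi E v) UNIV"
    and prod: "F (w ^ j * q) * D = infsetsum (\<lambda>v. lattice_sign e v * (w ^ j * q) powi E v) UNIV" for j
  proof -
    have u: "w ^ j * q \<noteq> 0" "norm (w ^ j * q) < 1"
      using w q by (simp_all add: norm_mult norm_power)
    have "(w ^ j * q) ^ M = q ^ M" if "m dvd M" for M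
    proof -
      from that obtain c where "M = m * c" by (elim dvdE)
      hence "(w ^ j) ^ M = (w ^ m) ^ (j * c)" by (simp only: power_mult [symmetric] ac_simps)
      thus ?thesis by (simp add: power_mult_distrib w(3))
    qed
    hence "(w ^ j * q) ^ A = q ^ A" "(w ^ j * q) ^ B = q ^ B" using dvd by auto
    with triple_theta_product[OF u e ab]
    show "Infinite_Set_Sum.abs_summable_on (\<lambda>v. lattice_sign e v * (w ^ j * q) powi E v) UNIV"
      and "F (w ^ j * q) * D = infsetsum (\<lambda>v. lattice_sign e v * (w ^ j * q) powi E v) UNIV"
      by (simp_all only: F_def D_def E_def)
  qed
  have "section_sum m r F q * D
          = (\<Sum>j<m. (w ^ j) powi (- r) * infsetsum (\<lambda>v. lattice_sign e v * (w ^ j * q) powi E v) UNIV)"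
    by (simp add: section_sum_def sum_distrib_right mult.assoc prod flip: w_def)
  also have "\<dots> = (\<Sum>j<m. infsetsum (\<lambda>v. (w ^ j) powi (- r) * (lattice_sign e v * (w ^ j * q) powi E v)) UNIV)"
    by (intro sum.cong refl infsetsum_cmult_right [symmetric] summ)
  also have "\<dots> = infsetsum (\<lambda>v. \<Sum>j<m. (w ^ j) powi (- r) * (lattice_sign e v * (w ^ j * q) powi E v)) UNIV"
    unfolding infsetsum_def
    by (intro Bochner_Integration.integral_sum [symmetric])
       (use summ in \<open>auto simp: abs_summable_on_def intro!: Bochner_Integration.integrable_mult_right\<close>)
  also have "\<dots> = infsetsum (\<lambda>v. (lattice_sign e v * q powi E v) * (\<Sum>j<m. (w ^ j) powi (E v - r))) UNIV"
    using w(1) by (simp add: sum_distrib_left power_int_mult_distrib power_int_diff power_int_minus field_simps)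
  also have "\<dots> = infsetsum (\<lambda>v. of_nat m * (lattice_sign e v * q powi E v)) {v. int m dvd E v - r}"
    by (rule infsetsum_cong_neutral) (auto simp: w_def sum_roots_of_unity_powi[OF m])
  also have "\<dots> = of_nat m * infsetsum (\<lambda>v. lattice_sign e v * q powi E v) {v. int m dvd E v - r}"
  proof (rule infsetsum_cmult_right)
    have "Infinite_Set_Sum.abs_summable_on (\<lambda>v. lattice_sign e v * q powi E v) UNIV"
      unfolding E_def by (rule triple_theta_product(1)[OF q e ab])
    thus "Infinite_Set_Sum.abs_summable_on (\<lambda>v. lattice_sign e v * q powi E v) {v. int m dvd E v - r}"
      by (rule abs_summable_on_subset) simp
  qed
  also have "infsetsum (\<lambda>v. lattice_sign e v * q powi E v) {v. int m dvd E v - r} = 0"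
    unfolding E_def
    by (rule lattice_sum_residue_class_eq_0[OF q(1) e ab(2) _ _ p odd_multiple]) (use dvd in simp_all)
  finally show ?thesis using D by (simp add: F_def)
qed

lemma coeff_eq_0_of_theta_product:
  fixes p r :: int and a A b B m n :: nat
  assumes f: "(\<lambda>q. qpoch_inf_list [q ^ a, q ^ (A - a)] (q ^ A)
           * (qpoch_inf_list [e * q ^ b, e * q ^ (B - b)] (q ^ B))\<^sup>2) has_fps_expansion Abs_fps c"
    and e: "e \<in> {1, -1}" and m: "m > 0"
    and ab: "a \<le> A" "A > 0" "b \<le> B" "B > 0" and dvd: "m dvd A" "m dvd B" and p: "odd p"
    and r: "\<not> int m dvd r" and n: "int m dvd int n - r"
    and odd_multiple: "\<And>x w. int m dvd int a * x + int b * w - r \<Longrightarrow>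
            \<exists>k. odd k \<and> 2 * int A * p * x + 2 * int B * w
                  + (2 * int a * p - int A * p + 4 * int b - 2 * int B)
                  = (int A * p\<^sup>2 + 2 * int B) * k"
  shows "c n = 0"
  using fps_nth_eq_0_if_section_sum_eq_0[OF f m section_sum_theta_product_eq_0[OF _ _ e m ab dvd p odd_multiple] r n]
  by simp

theorem theorem3p1:
  fixes \<epsilon> :: complex
    and a :: "nat \<Rightarrow> complex"
    and b c :: "nat \<Rightarrow> nat \<Rightarrow> complex"
  assumes "\<epsilon> \<in> {1, -1}"
    and "(\<lambda>q. qpoch_inf_list [q, q^4] (q^5)
                               * (qpoch_inf_list [\<epsilon> * q^6, \<epsilon> * q^9] (q^15))\<^sup>2)
           has_fps_expansion Abs_fps a"
    and "\<And>\<alpha>. \<alpha> \<le> 15 \<Longrightarrow>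
           (\<lambda>q. (qpoch_inf_list [\<epsilon> * q, \<epsilon> * q^4] (q^5))\<^sup>2
                                 * qpoch_inf_list [q^\<alpha>, q^(15 - \<alpha>)] (q^15))
           has_fps_expansion Abs_fps (b \<alpha>)"
    and "\<And>\<beta>. \<beta> \<le> 15 \<Longrightarrow>
           (\<lambda>q. (qpoch_inf_list [\<epsilon> * q^2, \<epsilon> * q^3] (q^5))\<^sup>2
                                 * qpoch_inf_list [q^\<beta>, q^(15 - \<beta>)] (q^15))
           has_fps_expansion Abs_fps (c \<beta>)"
  shows "\<forall>n. a (5*n + 3) = 0
           \<and> b 2 (5*n + 2) = 0 \<and> b 3 (5*n + 4) = 0 \<and> b 7 (5*n + 3) = 0
           \<and> c 1 (5*n + 3) = 0 \<and> c 4 (5*n + 4) = 0 \<and> c 6 (5*n + 1) = 0"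
proof (intro allI conjI)
  fix n :: nat
  have A: "(\<lambda>q. qpoch_inf_list [q ^ 1, q ^ (5 - 1)] (q ^ 5)
           * (qpoch_inf_list [\<epsilon> * q ^ 6, \<epsilon> * q ^ (15 - 6)] (q ^ 15))\<^sup>2) has_fps_expansion Abs_fps a"
    using assms(2) by simp
  have B: "(\<lambda>q. qpoch_inf_list [q ^ \<alpha>, q ^ (15 - \<alpha>)] (q ^ 15)
           * (qpoch_inf_list [\<epsilon> * q ^ 1, \<epsilon> * q ^ (5 - 1)] (q ^ 5))\<^sup>2) has_fps_expansion Abs_fps (b \<alpha>)"
    if "\<alpha> \<le> 15" for \<alpha> using assms(3)[OF that] by (simp add: mult.commute)
  have C: "(\<lambda>q. qpoch_inf_list [q ^ \<beta>, q ^ (15 - \<beta>)] (q ^ 15)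
           * (qpoch_inf_list [\<epsilon> * q ^ 2, \<epsilon> * q ^ (5 - 2)] (q ^ 5))\<^sup>2) has_fps_expansion Abs_fps (c \<beta>)"
    if "\<beta> \<le> 15" for \<beta> using assms(4)[OF that] by (simp add: mult.commute)
  \<comment> \<open>In each case \<open>p\<close> is the small odd number for which \<open>2 A p x + 2 B w\<close> is determined modulo \<open>N\<close>
     by the linear part of the exponent modulo \<open>5\<close>; the odd number named below is the quotient \<open>k\<close>.\<close>
  show "a (5*n + 3) = 0"
  proof (rule coeff_eq_0_of_theta_product[OF A assms(1), where m = 5 and p = 3 and r = 3])
    fix x w :: int
    assume "int 5 dvd int 1 * x + int 6 * w - 3"
    then obtain t where t: "1 * x + 6 * w - 3 = 5 * t" by auto
    hence "odd (2 * (t - w) + 1)" by simp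
    with t show "\<exists>k. odd k \<and> 2 * int 5 * 3 * x + 2 * int 15 * w + (2 * int 1 * 3 - int 5 * 3 + 4 * int 6 - 2 * int 15) = (int 5 * 3\<^sup>2 + 2 * int 15) * k"
      by (intro exI[of _ "2 * (t - w) + 1"]) auto
  qed (presburger | simp)+
  show "b 2 (5*n + 2) = 0"
  proof (rule coeff_eq_0_of_theta_product[OF B assms(1), where m = 5 and p = "-1" and r = 2])
    fix x w :: int
    assume "int 5 dvd int 2 * x + int 1 * w - 2"
    then obtain t where t: "2 * x + 1 * w - 2 = 5 * t" by auto
    hence "odd (2 * (t - x) + 1)" by simp
    with t show "\<exists>k. odd k \<and> 2 * int 15 * (- 1) * x + 2 * int 5 * w + (2 * int 2 * (- 1) - int 15 * (- 1) + 4 * int 1 - 2 * int 5) = (int 15 * (- 1)\<^sup>2 + 2 * int 5) * k"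
      by (intro exI[of _ "2 * (t - x) + 1"]) auto
  qed (presburger | simp)+
  show "b 3 (5*n + 4) = 0"
  proof (rule coeff_eq_0_of_theta_product[OF B assms(1), where m = 5 and p = 1 and r = 4])
    fix x w :: int
    assume "int 5 dvd int 3 * x + int 1 * w - 4"
    then obtain t where t: "3 * x + 1 * w - 4 = 5 * t" by auto
    hence "odd (2 * t + 1)" by simp
    with t show "\<exists>k. odd k \<and> 2 * int 15 * 1 * x + 2 * int 5 * w + (2 * int 3 * 1 - int 15 * 1 + 4 * int 1 - 2 * int 5) = (int 15 * 1\<^sup>2 + 2 * int 5) * k"
      by (intro exI[of _ "2 * t + 1"]) auto
  qed (presburger | simp)+
  show "b 7 (5*n + 3) = 0"
  proof (rule coeff_eq_0_of_theta_product[OF B assms(1), where m = 5 and p = "-1" and r = 3])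
    fix x w :: int
    assume "int 5 dvd int 7 * x + int 1 * w - 3"
    then obtain t where t: "7 * x + 1 * w - 3 = 5 * t" by auto
    hence "odd (2 * (t - 2 * x) + 1)" by simp
    with t show "\<exists>k. odd k \<and> 2 * int 15 * (- 1) * x + 2 * int 5 * w + (2 * int 7 * (- 1) - int 15 * (- 1) + 4 * int 1 - 2 * int 5) = (int 15 * (- 1)\<^sup>2 + 2 * int 5) * k"
      by (intro exI[of _ "2 * (t - 2 * x) + 1"]) auto
  qed (presburger | simp)+
  show "c 1 (5*n + 3) = 0"
  proof (rule coeff_eq_0_of_theta_product[OF C assms(1), where m = 5 and p = 1 and r = 3])
    fix x w :: int
    assume "int 5 dvd int 1 * x + int 2 * w - 3"
    then obtain t where t: "1 * x + 2 * w - 3 = 5 * t" by auto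
    hence "odd (2 * (3 * t - w + 1) + 1)" by simp
    with t show "\<exists>k. odd k \<and> 2 * int 15 * 1 * x + 2 * int 5 * w + (2 * int 1 * 1 - int 15 * 1 + 4 * int 2 - 2 * int 5) = (int 15 * 1\<^sup>2 + 2 * int 5) * k"
      by (intro exI[of _ "2 * (3 * t - w + 1) + 1"]) auto
  qed (presburger | simp)+
  show "c 4 (5*n + 4) = 0"
  proof (rule coeff_eq_0_of_theta_product[OF C assms(1), where m = 5 and p = "-1" and r = 4])
    fix x w :: int
    assume "int 5 dvd int 4 * x + int 2 * w - 4"
    then obtain t where t: "4 * x + 2 * w - 4 = 5 * t" by auto
    hence "odd (t - 2 * x + 1)" by presburger
    with t show "\<exists>k. odd k \<and> 2 * int 15 * (- 1) * x + 2 * int 5 * w + (2 * int 4 * (- 1) - int 15 * (- 1) + 4 * int 2 - 2 * int 5) = (int 15 * (- 1)\<^sup>2 + 2 * int 5) * k"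
      by (intro exI[of _ "t - 2 * x + 1"]) auto
  qed (presburger | simp)+
  show "c 6 (5*n + 1) = 0"
  proof (rule coeff_eq_0_of_theta_product[OF C assms(1), where m = 5 and p = 1 and r = 1])
    fix x w :: int
    assume "int 5 dvd int 6 * x + int 2 * w - 1"
    then obtain t where t: "6 * x + 2 * w - 1 = 5 * t" by auto
    hence "odd t" by presburger
    with t show "\<exists>k. odd k \<and> 2 * int 15 * 1 * x + 2 * int 5 * w + (2 * int 6 * 1 - int 15 * 1 + 4 * int 2 - 2 * int 5) = (int 15 * 1\<^sup>2 + 2 * int 5) * k"
      by (intro exI[of _ t]) auto
  qed (presburger | simp)+
qed

end
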